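(* For any $A\in\mathbb{C}^{n\times n}$ there exists a unitary matrix $U\in\mathbb{C}^{n\times n}$ (that is, $U^*U=E$) such that $d_r(A,U)\le d_r(A^*A,E)$.
   Context: $A^*$ denotes the adjoint (conjugate transpose) of $A$ and $E$ the $n\times n$ identity matrix. For $A,B\in\mathbb{C}^{n\times n}$, $d_r(A,B)=\frac{\operatorname{rank}(A-B)}{n}$ is the normalized arithmetic distance. *)

theory Defs
  imports
    "Jordan_Normal_Form.DL_Rank"
    "Jordan_Normal_Form.Schur_Decomposition"
begin

text \<open>The normalized arithmetic distance of two \<open>n \<times> n\<close> matrices. The dimension \<open>n\<close> is an
  argument because \<^const>\<open>vec_space.rank\<close> takes it: it is the number of rows, i.e. the
  dimension of the space containing the columns.\<close>

definition norm_arith_dist :: "nat \<Rightarrow> complex mat \<Rightarrow> complex mat \<Rightarrow> real" where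
  "norm_arith_dist n A B = real (vec_space.rank n (A - B)) / real n"

end

theory Submission
  imports Defs
begin

text \<open>Take a maximal orthonormal family \<open>v\<^sub>1, \<dots>, v\<^sub>k\<close> in the kernel of \<open>A\<^sup>*A - E\<close>. Since
  \<open>\<langle>A v\<^sub>i, A v\<^sub>j\<rangle> = \<langle>v\<^sub>i, A\<^sup>*A v\<^sub>j\<rangle> = \<langle>v\<^sub>i, v\<^sub>j\<rangle>\<close>, the vectors \<open>A v\<^sub>i\<close> are orthonormal too, so both
  families extend to unitary matrices \<open>V\<close> and \<open>W\<close>, and \<open>U = W V\<^sup>*\<close> agrees with \<open>A\<close> on
  \<open>v\<^sub>1, \<dots>, v\<^sub>k\<close>. Then \<open>rank (A - U) = rank ((A V - W) V\<^sup>*) \<le> n - k\<close> because the first \<open>k\<close>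
  columns of \<open>A V - W\<close> vanish, while by maximality of \<open>k\<close> the matrix \<open>A\<^sup>*A - E\<close> is injective on
  the span of the remaining columns of \<open>V\<close>, so that its rank is at least \<open>n - k\<close>.\<close>

section \<open>Rank bounds read off from columns and kernels\<close>

text \<open>Each column of \<open>A * B\<close> is \<open>A\<close> applied to a column of
  \<open>B\<close>, so the column spaces are nested. This serves both to discard the factor
  \<open>mat_adjoint V\<close> and to bound the rank of \<open>H - 1\<^sub>m n\<close> from below by
  restricting it to a subspace.\<close>

lemma (in vec_space) rank_mult_le:
  assumes A: "A \<in> carrier_mat n m" and B: "B \<in> carrier_mat m p"
  shows "rank (A * B) \<le> rank A"
proof -
  have cA: "set (cols A) \<subseteq> carrier_vec n" using A cols_dim by blast
  have AB: "A * B \<in> carrier_mat n p" using A B by simp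
  have cAB: "set (cols (A * B)) \<subseteq> carrier_vec n" using AB cols_dim by blast
  have "set (cols (A * B)) \<subseteq> span (set (cols A))"
  proof
    fix x assume "x \<in> set (cols (A * B))"
    then obtain j where j: "j < p" and x: "x = col (A * B) j"
      using AB by (metis carrier_matD(2) cols_length cols_nth in_set_conv_nth)
    have "x = A *\<^sub>v col B j" using x col_mult2[OF A B j] by simp
    moreover have "col B j \<in> carrier_vec m" using B by auto
    ultimately have "x \<in> col_space A" unfolding col_space_eq[OF A] using A by auto
    then show "x \<in> span (set (cols A))" by (simp add: col_space_def)
  qed
  then have "span (set (cols (A * B))) \<subseteq> span (set (cols A))"
    by (rule span_subsetI[OF cA])
  then have "VectorSpace.subspace class_ring (span (set (cols (A * B)))) (vs (span (set (cols A))))"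
    using nested_subspaces cA cAB by (simp add: span_is_subspace)
  moreover have "VectorSpace.subspace class_ring (span (set (cols A))) V"
    using cA by (simp add: span_is_subspace)
  ultimately show ?thesis
    unfolding rank_def
    using vectorspace.subspace_dim[OF subspace_is_vs] fin_dim_span_cols[OF A] fin_dim_span_cols[OF AB]
    by auto
qed

text \<open>The rank is the size of a maximal independent set of columns. Such a set avoids the zero
  vector, so all its members are columns with index at least \<open>k\<close>.\<close>

lemma (in vec_space) rank_le_of_zero_cols:
  assumes A: "A \<in> carrier_mat n nc" and z: "\<And>j. j < k \<Longrightarrow> col A j = 0\<^sub>v n" and "k \<le> nc"
  shows "rank A \<le> nc - k"
proof -
  obtain S where S: "maximal S (\<lambda>T. T \<subseteq> set (cols A) \<and> lin_indpt T)"
    using maximal_exists_superset[of "set (cols A)" "\<lambda>T. T \<subseteq> set (cols A) \<and> lin_indpt T" "{}"]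
    by (meson List.finite_set empty_subsetI fin_dim finite_basis_exists subset_li_is_li basis_def)
  then have sub: "S \<subseteq> set (cols A)" and li: "lin_indpt S" by (auto simp: maximal_def)
  have cS: "S \<subseteq> carrier_vec n" using sub A cols_dim by blast
  have "0\<^sub>v n \<notin> S"
    using zero_nin_lin_indpt[OF _ li] cS class_semiring.one_zeroI by auto
  have "S \<subseteq> col A ` {k..<nc}"
  proof
    fix x assume x: "x \<in> S"
    then obtain j where j: "j < nc" "x = col A j"
      using sub A by (metis carrier_matD(2) cols_length cols_nth in_set_conv_nth subsetD)
    then have "k \<le> j" using z[of j] x \<open>0\<^sub>v n \<notin> S\<close> by (metis not_le)
    then show "x \<in> col A ` {k..<nc}" using j by auto
  qed
  then have "card S \<le> nc - k"
    using surj_card_le[of "{k..<nc}" S "col A"] by simp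
  then show ?thesis using rank_card_indpt[OF A S] by simp
qed

lemma (in vec_space) rank_eq_of_trivial_kernel:
  assumes A: "A \<in> carrier_mat n nc"
    and inj: "\<And>v. v \<in> carrier_vec nc \<Longrightarrow> A *\<^sub>v v = 0\<^sub>v n \<Longrightarrow> v = 0\<^sub>v nc"
  shows "rank A = nc"
proof -
  \<comment> \<open>Independence is stated for the set of columns, which forgets repetitions. Two
    equal columns would put a difference of unit vectors into the kernel.\<close>
  have dist: "distinct (cols A)"
    unfolding distinct_conv_nth
  proof (intro allI impI)
    fix i j assume ij: "i < length (cols A)" "j < length (cols A)" "i \<noteq> j"
    then have i: "i < nc" and j: "j < nc" using A by auto
    have "A *\<^sub>v (unit_vec nc i - unit_vec nc j) \<noteq> 0\<^sub>v n"
    proof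
      assume "A *\<^sub>v (unit_vec nc i - unit_vec nc j) = 0\<^sub>v n"
      then have "unit_vec nc i - unit_vec nc j = (0\<^sub>v nc :: 'a vec)" using inj by auto
      then have "(unit_vec nc i - unit_vec nc j) $ i = (0::'a)" using i by simp
      then show False using i j ij by simp
    qed
    moreover have "A *\<^sub>v (unit_vec nc i - unit_vec nc j) = col A i - col A j"
      using A i j
      by (intro eq_vecI) (auto simp: scalar_prod_minus_distrib[of _ nc])
    ultimately show "cols A ! i \<noteq> cols A ! j" using A i j by auto
  qed
  moreover have "lin_indpt (set (cols A))"
    using lin_depE[OF A _ dist] inj by blast
  ultimately show ?thesis by (rule lin_indpt_full_rank[OF A])
qed

section \<open>Calculus of the adjoint\<close>

lemma mat_adjoint_dims [simp]:
  "dim_row (mat_adjoint A) = dim_col A" "dim_col (mat_adjoint A) = dim_row A"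
  by (simp_all add: mat_adjoint_def)

lemma mat_adjoint_carrier [simp]: "A \<in> carrier_mat m n \<Longrightarrow> mat_adjoint A \<in> carrier_mat n m"
  by auto

lemma mat_adjoint_index:
  "i < dim_col A \<Longrightarrow> j < dim_row A \<Longrightarrow> mat_adjoint A $$ (i, j) = conjugate (A $$ (j, i))"
  unfolding mat_adjoint_def by (simp add: mat_of_rows_index)

text \<open>The product \<open>\<bullet>c\<close> conjugates its second argument, so the column of
  \<open>A\<close> comes second.\<close>

lemma mat_adjoint_mult_index:
  assumes "A \<in> carrier_mat m p" "B \<in> carrier_mat m q" "i < p" "j < q"
  shows "(mat_adjoint A * B) $$ (i, j) = col B j \<bullet>c col A i"
proof -
  have "(mat_adjoint A * B) $$ (i, j) = row (mat_adjoint A) i \<bullet> col B j"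
    using assms mat_adjoint_carrier[OF assms(1)] by (intro index_mult_mat) auto
  also have "row (mat_adjoint A) i = conjugate (col A i)"
    using assms mat_adjoint_carrier[OF assms(1)]
    by (intro eq_vecI) (auto simp: mat_adjoint_index)
  finally show ?thesis
    using assms conjugate_vec_sprod_comm[of "col B j" m "col A i"] by auto
qed

lemma mat_adjoint_mult:
  fixes A B :: "'a :: conjugatable_field mat"
  assumes A: "A \<in> carrier_mat m p" and B: "B \<in> carrier_mat p q"
  shows "mat_adjoint (A * B) = mat_adjoint B * mat_adjoint A"
  using A B mat_adjoint_carrier[OF A] mat_adjoint_carrier[OF B]
    mat_adjoint_carrier[OF mult_carrier_mat[OF A B]]
  by (intro eq_matI)
    (auto simp: mat_adjoint_index scalar_prod_def sum_conjugate conjugate_dist_mul mult.commute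
      intro!: sum.cong)

lemma mat_adjoint_adjoint: "mat_adjoint (mat_adjoint A) = A"
  using mat_adjoint_carrier[of A "dim_row A" "dim_col A"]
    mat_adjoint_carrier[of "mat_adjoint A" "dim_col A" "dim_row A"]
  by (intro eq_matI) (auto simp: mat_adjoint_index)

lemma mat_adjoint_inner:
  assumes A: "A \<in> carrier_mat m p" and v: "v \<in> carrier_vec p" and w: "w \<in> carrier_vec m"
  shows "(A *\<^sub>v v) \<bullet>c w = v \<bullet>c (mat_adjoint A *\<^sub>v w)"
proof -
  have "(A *\<^sub>v v) \<bullet>c w = (\<Sum>i<m. \<Sum>j<p. A $$ (i, j) * v $ j * conjugate (w $ i))"
    using assms by (simp add: scalar_prod_def sum_distrib_right atLeast0LessThan)
  also have "\<dots> = (\<Sum>j<p. \<Sum>i<m. A $$ (i, j) * v $ j * conjugate (w $ i))"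
    by (rule sum.swap)
  also have "\<dots> = v \<bullet>c (mat_adjoint A *\<^sub>v w)"
    using assms mat_adjoint_carrier[OF A]
    by (simp add: scalar_prod_def sum_distrib_left atLeast0LessThan mat_adjoint_index
        sum_conjugate conjugate_dist_mul mult_ac)
  finally show ?thesis .
qed

section \<open>Orthonormal families and their extension to bases\<close>

text \<open>Values of \<open>q\<close> from \<open>k\<close> on are unconstrained, so a family is
  prolonged by a function update at \<open>k\<close>.\<close>

definition orthonormal :: "nat \<Rightarrow> nat \<Rightarrow> (nat \<Rightarrow> complex vec) \<Rightarrow> bool" where
  "orthonormal n k q \<longleftrightarrow> (\<forall>i<k. q i \<in> carrier_vec n) \<and>
    (\<forall>i<k. \<forall>j<k. q i \<bullet>c q j = (if i = j then 1 else 0))"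

lemma normalize_vec:
  fixes x :: "complex vec"
  assumes x: "x \<in> carrier_vec n" and "x \<noteq> 0\<^sub>v n"
  obtains c where "(c \<cdot>\<^sub>v x) \<bullet>c (c \<cdot>\<^sub>v x) = 1"
proof -
  have pos: "x \<bullet>c x > 0" using assms by simp
  \<comment> \<open>Positivity in the order on the complex numbers includes a vanishing imaginary
    part, so \<open>x \<bullet>c x\<close> equals its real part.\<close>
  define r where "r = Re (x \<bullet>c x)"
  have r: "x \<bullet>c x = complex_of_real r" "r > 0"
    using pos by (auto simp: r_def less_complex_def complex_eq_iff)
  define c where "c = complex_of_real (1 / sqrt r)"
  have "(c \<cdot>\<^sub>v x) \<bullet>c (c \<cdot>\<^sub>v x) = c * c * (x \<bullet>c x)"
    using x by (simp add: conjugate_smult_vec c_def)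
  also have "\<dots> = complex_of_real (1 / sqrt r * (1 / sqrt r) * r)"
    unfolding c_def r by (simp only: of_real_mult)
  also have "1 / sqrt r * (1 / sqrt r) * r = 1"
    using r(2) by (simp add: field_simps)
  finally show ?thesis using that by simp
qed

lemma orthonormal_Suc:
  assumes o: "orthonormal n k q" and x: "x \<in> carrier_vec n" "x \<noteq> 0\<^sub>v n"
    and orth: "\<And>i. i < k \<Longrightarrow> x \<bullet>c q i = 0"
  obtains c where "orthonormal n (Suc k) (q(k := c \<cdot>\<^sub>v x))"
proof -
  obtain c where c: "(c \<cdot>\<^sub>v x) \<bullet>c (c \<cdot>\<^sub>v x) = 1" using normalize_vec[OF x] .
  have q: "q i \<in> carrier_vec n" if "i < k" for i using o that by (simp add: orthonormal_def)
  have 1: "(c \<cdot>\<^sub>v x) \<bullet>c q i = 0" if "i < k" for i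
    using that orth q x by simp
  have 2: "q i \<bullet>c (c \<cdot>\<^sub>v x) = 0" if "i < k" for i
  proof -
    have "q i \<bullet>c (c \<cdot>\<^sub>v x) = conjugate ((c \<cdot>\<^sub>v x) \<bullet>c q i)"
      using q[OF that] x
      by (metis carrier_vec_conjugate conjugate_conjugate_sprod conjugate_vec_sprod_comm smult_carrier_vec)
    then show ?thesis using 1[OF that] by simp
  qed
  have "orthonormal n (Suc k) (q(k := c \<cdot>\<^sub>v x))"
    unfolding orthonormal_def using o x c 1 2
    by (auto simp: orthonormal_def less_Suc_eq)
  then show ?thesis by (rule that)
qed

text \<open>Orthogonality to fewer than \<open>n\<close> vectors is a linear system that zero rows
  pad to a square one. A zero row makes the determinant vanish, and a nonzero kernel vector is the
  desired \<open>x\<close>.\<close>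

lemma exists_orthogonal_vec:
  fixes q :: "nat \<Rightarrow> complex vec"
  assumes q: "\<And>i. i < k \<Longrightarrow> q i \<in> carrier_vec n" and k: "k < n"
  obtains x where "x \<in> carrier_vec n" "x \<noteq> 0\<^sub>v n" "\<And>i. i < k \<Longrightarrow> x \<bullet>c q i = 0"
proof -
  \<comment> \<open>The default \<open>0\<^sub>v n\<close> gives every row the right dimension, as
    \<open>det_row_0\<close> requires.\<close>
  define c where "c i = (if i < k then conjugate (q i) else 0\<^sub>v n)" for i
  have cc: "c i \<in> carrier_vec n" for i using q by (simp add: c_def)
  define M where "M = mat\<^sub>r n n (\<lambda>i. if i = k then 0\<^sub>v n else c i)"
  have M: "M \<in> carrier_mat n n" by (simp add: M_def)
  have "det M = 0" unfolding M_def by (rule det_row_0[OF k]) (use cc in auto)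
  then obtain x where x: "x \<in> carrier_vec n" "x \<noteq> 0\<^sub>v n" "M *\<^sub>v x = 0\<^sub>v n"
    using det_0_iff_vec_prod_zero[OF M] by blast
  have "x \<bullet>c q i = 0" if i: "i < k" for i
  proof -
    have "row M i = conjugate (q i)" using i k carrier_vecD[OF cc[of i]] unfolding M_def
      by (subst row_mat_of_row_fun) (auto simp: c_def)
    then have "conjugate (q i) \<bullet> x = (M *\<^sub>v x) $ i" using M i k by simp
    also have "\<dots> = 0" using x(3) i k by simp
    finally show ?thesis using conjugate_vec_sprod_comm[OF x(1) q[OF i]] by simp
  qed
  then show ?thesis using x that by blast
qed

lemma orthonormal_extend:
  assumes "orthonormal n k q" "k \<le> n"
  obtains q' where "orthonormal n n q'" "\<And>i. i < k \<Longrightarrow> q' i = q i"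
proof -
  have "\<exists>q'. orthonormal n m q' \<and> (\<forall>i<k. q' i = q i)" if "k \<le> m" "m \<le> n" for m
    using that
  proof (induction m rule: dec_induct)
    case base
    then show ?case using assms by blast
  next
    case (step m)
    then obtain q' where q': "orthonormal n m q'" "\<forall>i<k. q' i = q i" by auto
    obtain x where x: "x \<in> carrier_vec n" "x \<noteq> 0\<^sub>v n" "\<And>i. i < m \<Longrightarrow> x \<bullet>c q' i = 0"
      using exists_orthogonal_vec[of m q' n] q'(1) step by (auto simp: orthonormal_def)
    obtain c where "orthonormal n (Suc m) (q'(m := c \<cdot>\<^sub>v x))"
      using orthonormal_Suc[OF q'(1) x] .
    moreover have "\<forall>i<k. (q'(m := c \<cdot>\<^sub>v x)) i = q i" using q'(2) \<open>k \<le> m\<close> by simp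
    ultimately show ?case by blast
  qed
  then show ?thesis using assms(2) that by blast
qed

lemma orthonormal_adjoint_mult:
  assumes "orthonormal n k q"
  shows "mat_adjoint (mat n k (\<lambda>(i, j). q j $ i)) * mat n k (\<lambda>(i, j). q j $ i) = 1\<^sub>m k"
    (is "mat_adjoint ?Q * ?Q = _")
proof (rule eq_matI)
  have Q: "?Q \<in> carrier_mat n k" by simp
  fix i j assume ij: "i < dim_row (1\<^sub>m k)" "j < dim_col (1\<^sub>m k)"
  have c: "col ?Q j = q j" if "j < k" for j
    using assms that by (intro eq_vecI) (auto simp: orthonormal_def)
  show "(mat_adjoint ?Q * ?Q) $$ (i, j) = 1\<^sub>m k $$ (i, j)"
    using ij assms mat_adjoint_mult_index[OF Q Q, of i j] c by (auto simp: orthonormal_def)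
qed (use mat_adjoint_carrier[of "mat n k (\<lambda>(i, j). q j $ i)" n k] in auto)

section \<open>Construction of the unitary matrix and comparison of ranks\<close>

theorem theorem7:
  fixes n :: nat and A :: "complex mat"
  assumes "A \<in> carrier_mat n n"
  shows "\<exists>U \<in> carrier_mat n n. mat_adjoint U * U = 1\<^sub>m n \<and>
    norm_arith_dist n A U \<le> norm_arith_dist n (mat_adjoint A * A) (1\<^sub>m n)"
proof -
  note A = assms
  define H where "H = mat_adjoint A * A"
  have Ad: "mat_adjoint A \<in> carrier_mat n n" using A by simp
  have H: "H \<in> carrier_mat n n" unfolding H_def by (rule mult_carrier_mat[OF Ad A])
  have HI: "H - 1\<^sub>m n \<in> carrier_mat n n" by (rule minus_carrier_mat) simp
  \<comment> \<open>The kernel of \<open>H - 1\<^sub>m n\<close> appears as the fixed vectors of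
    \<open>H\<close>. The empty family gives \<open>0 \<in> K\<close>, so a maximal length
    exists.\<close>
  define P where "P k q \<longleftrightarrow> orthonormal n k q \<and> (\<forall>i<k. H *\<^sub>v q i = q i)" for k q
  define K where "K = {k. k \<le> n \<and> (\<exists>q. P k q)}"
  have K: "finite K" "K \<noteq> {}"
    by (auto simp: K_def P_def orthonormal_def intro!: exI[of _ 0])
  define k where "k = Max K"
  have kn: "k \<le> n" and "\<exists>q. P k q" using Max_in[OF K] by (auto simp: k_def K_def)
  then obtain q where q: "orthonormal n k q" "\<And>i. i < k \<Longrightarrow> H *\<^sub>v q i = q i"
    by (auto simp: P_def)
  have kmax: "m \<le> k" if "m \<le> n" "P m p" for m p
    unfolding k_def by (rule Max_ge[OF K(1)]) (use that in \<open>auto simp: K_def\<close>)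
  obtain v where v: "orthonormal n n v" "\<And>i. i < k \<Longrightarrow> v i = q i"
    using orthonormal_extend[OF q(1) kn] by blast
  have vc: "v i \<in> carrier_vec n" if "i < n" for i using v(1) that by (simp add: orthonormal_def)
  have Hv: "H *\<^sub>v v i = v i" if "i < k" for i using q(2) v(2) that by simp
  have Pkv: "P k v" using v(1) Hv kn by (auto simp: P_def orthonormal_def)

  have "orthonormal n k (\<lambda>i. A *\<^sub>v v i)"
    unfolding orthonormal_def
  proof (intro conjI allI impI)
    fix i j assume ij: "i < k" "j < k"
    then have c: "v i \<in> carrier_vec n" "v j \<in> carrier_vec n" using vc kn by auto
    have "(A *\<^sub>v v i) \<bullet>c (A *\<^sub>v v j) = v i \<bullet>c (mat_adjoint A *\<^sub>v (A *\<^sub>v v j))"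
      using mat_adjoint_inner[OF A c(1)] A c by simp
    also have "mat_adjoint A *\<^sub>v (A *\<^sub>v v j) = v j"
      using Hv[OF ij(2)] assoc_mult_mat_vec[OF Ad A c(2)] by (simp add: H_def)
    finally show "(A *\<^sub>v v i) \<bullet>c (A *\<^sub>v v j) = (if i = j then 1 else 0)"
      using v(1) ij kn by (simp add: orthonormal_def)
  qed (use A vc kn in auto)
  then obtain w where w: "orthonormal n n w" "\<And>i. i < k \<Longrightarrow> w i = A *\<^sub>v v i"
    using orthonormal_extend[OF _ kn] by blast

  define V where "V = mat n n (\<lambda>(i, j). v j $ i)"
  define W where "W = mat n n (\<lambda>(i, j). w j $ i)"
  have V: "V \<in> carrier_mat n n" and W: "W \<in> carrier_mat n n" by (auto simp: V_def W_def)
  have Vd: "mat_adjoint V \<in> carrier_mat n n" and Wd: "mat_adjoint W \<in> carrier_mat n n"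
    using V W by auto
  have VV: "mat_adjoint V * V = 1\<^sub>m n" and WW: "mat_adjoint W * W = 1\<^sub>m n"
    using orthonormal_adjoint_mult v(1) w(1) by (auto simp: V_def W_def)
  have VV': "V * mat_adjoint V = 1\<^sub>m n"
    by (rule mat_mult_left_right_inverse[OF Vd V VV])
  have colV: "col V j = v j" if "j < n" for j
    using that vc[OF that] by (intro eq_vecI) (auto simp: V_def)
  have colW: "col W j = w j" if "j < n" for j
    using that w(1) by (intro eq_vecI) (auto simp: W_def orthonormal_def)
  \<comment> \<open>This is the change of basis taking each \<open>v j\<close> to
    \<open>w j\<close>.\<close>
  define U where "U = W * mat_adjoint V"
  have U: "U \<in> carrier_mat n n" using W Vd by (simp add: U_def)
  have "mat_adjoint U * U = (V * mat_adjoint W) * (W * mat_adjoint V)"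
    unfolding U_def mat_adjoint_mult[OF W Vd] mat_adjoint_adjoint ..
  also have "\<dots> = V * ((mat_adjoint W * W) * mat_adjoint V)"
    using V W Vd Wd by (simp add: assoc_mult_mat[of _ n n _ n _ n])
  also have "\<dots> = 1\<^sub>m n" using VV' left_mult_one_mat[OF Vd] by (simp add: WW)
  finally have UU: "mat_adjoint U * U = 1\<^sub>m n" .

  \<comment> \<open>Since \<open>V * mat_adjoint V\<close> is the identity, \<open>A\<close> can be
    written as \<open>A * V * mat_adjoint V\<close>.\<close>
  have "A - U = (A * V - W) * mat_adjoint V"
    using A V W Vd
    by (simp add: U_def minus_mult_distrib_mat[of _ n n _ _ n] assoc_mult_mat[of _ n n _ n _ n] VV')
  then have "vec_space.rank n (A - U) \<le> vec_space.rank n (A * V - W)"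
    using vec_space.rank_mult_le[of "A * V - W" n n "mat_adjoint V" n] A V W Vd
    by (simp add: minus_carrier_mat)
  also have "\<dots> \<le> n - k"
  proof (rule vec_space.rank_le_of_zero_cols[OF _ _ kn])
    show "A * V - W \<in> carrier_mat n n" using W by (rule minus_carrier_mat)
    fix j assume j: "j < k"
    then have jn: "j < n" using kn by simp
    have "col (A * V - W) j = col (A * V) j - col W j"
      using A V W jn by (intro eq_vecI) auto
    also have "col (A * V) j = A *\<^sub>v v j" using col_mult2[OF A V jn] colV[OF jn] by simp
    also have "col W j = A *\<^sub>v v j" using colW[OF jn] w(2)[OF j] by simp
    finally show "col (A * V - W) j = 0\<^sub>v n" using A vc[OF jn] by simp
  qed
  also have "n - k \<le> vec_space.rank n (H - 1\<^sub>m n)"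
  proof -
    \<comment> \<open>The columns of \<open>T\<close> are the vectors added to the maximal family.
      It suffices that \<open>H - 1\<^sub>m n\<close> is injective on their span, for then its
      product with \<open>T\<close> already has rank \<open>n - k\<close>.\<close>
    define T where "T = mat n (n - k) (\<lambda>(i, j). v (k + j) $ i)"
    have T: "T \<in> carrier_mat n (n - k)" by (simp add: T_def)
    have HT: "(H - 1\<^sub>m n) * T \<in> carrier_mat n (n - k)" using HI T by (rule mult_carrier_mat)
    have colT: "col T j = v (k + j)" if "j < n - k" for j
    proof -
      have "v (k + j) \<in> carrier_vec n" using vc that by simp
      then show ?thesis using that by (intro eq_vecI) (auto simp: T_def)
    qed
    have "orthonormal n (n - k) (\<lambda>j. v (k + j))"
      using v(1) by (auto simp: orthonormal_def)
    then have TT: "mat_adjoint T * T = 1\<^sub>m (n - k)"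
      unfolding T_def by (rule orthonormal_adjoint_mult)
    have "vec_space.rank n ((H - 1\<^sub>m n) * T) = n - k"
    proof (rule vec_space.rank_eq_of_trivial_kernel[OF HT], rule ccontr)
      fix y assume y: "y \<in> carrier_vec (n - k)" "(H - 1\<^sub>m n) * T *\<^sub>v y = 0\<^sub>v n"
        and y0: "y \<noteq> 0\<^sub>v (n - k)"
      define x where "x = T *\<^sub>v y"
      have x: "x \<in> carrier_vec n" using T y by (simp add: x_def)
      \<comment> \<open>The adjoint of \<open>T\<close> is a left inverse and recovers
        \<open>y\<close>, so \<open>x\<close> is nonzero along with \<open>y\<close>.\<close>
      have Ty: "mat_adjoint T *\<^sub>v x = y"
        using assoc_mult_mat_vec[OF mat_adjoint_carrier[OF T] T y(1)] y(1)
        by (simp add: x_def TT)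
      have x0: "x \<noteq> 0\<^sub>v n"
      proof
        assume "x = 0\<^sub>v n"
        then have "mat_adjoint T *\<^sub>v x = 0\<^sub>v (n - k)"
          using T by (intro eq_vecI) (auto simp: scalar_prod_def)
        then show False using Ty y0 by simp
      qed
      have "0\<^sub>v n = (H - 1\<^sub>m n) *\<^sub>v x"
        using y assoc_mult_mat_vec[OF HI T y(1)] by (simp add: x_def)
      also have "\<dots> = H *\<^sub>v x - x"
        using x H by (simp add: minus_mult_distrib_mat_vec[of _ n n])
      finally have Hx: "H *\<^sub>v x = x"
        using H x by (metis carrier_vecD eq_vecI index_minus_vec(1) index_zero_vec(1)
          mult_mat_vec_carrier right_minus_eq)
      \<comment> \<open>Moving \<open>T\<close> across the inner product leaves
        \<open>mat_adjoint T *\<^sub>v v i\<close>, whose entries are inner products of distinct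
        members of the basis.\<close>
      have xo: "x \<bullet>c v i = 0" if i: "i < k" for i
      proof -
        have vi: "v i \<in> carrier_vec n" using vc i kn by simp
        have "mat_adjoint T *\<^sub>v v i = 0\<^sub>v (n - k)"
        proof (rule eq_vecI)
          fix j assume "j < dim_vec (0\<^sub>v (n - k))"
          then have j: "j < n - k" by simp
          have "(mat_adjoint T *\<^sub>v v i) $ j = (mat_adjoint T * V) $$ (j, i)"
            using T V j i kn colV[of i] by auto
          also have "\<dots> = v i \<bullet>c v (k + j)"
            using mat_adjoint_mult_index[OF T V j] i kn colV[of i] colT[OF j] by simp
          also have "\<dots> = 0" using v(1) i j by (simp add: orthonormal_def)
          finally show "(mat_adjoint T *\<^sub>v v i) $ j = 0\<^sub>v (n - k) $ j" using j by simp
        qed (use mat_adjoint_carrier[OF T] in auto)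
        then show ?thesis
          using mat_adjoint_inner[OF T y(1) vi] y(1) by (simp add: x_def)
      qed
      have "orthonormal n k v" using Pkv by (simp add: P_def)
      then obtain c where "orthonormal n (Suc k) (v(k := c \<cdot>\<^sub>v x))"
        using orthonormal_Suc x x0 xo by metis
      \<comment> \<open>A multiple of \<open>x\<close> is again fixed by \<open>H\<close>, so the
        family of length \<open>k\<close> was not maximal.\<close>
      then have "P (Suc k) (v(k := c \<cdot>\<^sub>v x))"
        using Hv Hx H x by (auto simp: P_def less_Suc_eq mult_mat_vec)
      \<comment> \<open>Membership in \<open>K\<close> needs this bound. For \<open>k = n\<close>
        the vector \<open>y\<close> has dimension 0 and cannot be nonzero.\<close>
      moreover have "Suc k \<le> n"
      proof (rule ccontr)
        assume "\<not> Suc k \<le> n"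
        then have "y = 0\<^sub>v (n - k)" using y(1) by (intro eq_vecI) auto
        then show False using y0 by simp
      qed
      ultimately show False using kmax by fastforce
    qed
    then show ?thesis using vec_space.rank_mult_le[OF HI T] by simp
  qed
  \<comment> \<open>The case \<open>n = 0\<close> is covered, because division by zero yields 0 on
    both sides.\<close>
  finally have "norm_arith_dist n A U \<le> norm_arith_dist n H (1\<^sub>m n)"
    by (simp add: norm_arith_dist_def divide_right_mono)
  then show ?thesis using U UU by (auto simp: H_def)
qed

end
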